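(* Let $A$ be a Banach algebra with a bounded approximate identity. Then: (i) $\mathcal{H}_r(A^* )=\mathcal{H}_r^\sigma(A^* )$ if and only if $A$ is a right ideal of $A^{**}$; (ii) $\mathcal{H}_\ell(A^* )=\mathcal{H}_\ell^\sigma(A^* )$ if and only if $A$ is a left ideal of $A^{**}$.
   Context: For $\omega\in A$, $x\in A^*$ define $x\cdot\omega,\ \omega\cdot x\in A^*$ by $(x\cdot\omega)(\nu)=x(\omega\nu)$, $(\omega\cdot x)(\nu)=x(\nu\omega)$ ($\nu\in A$). $A^{**}$ carries the first Arens product $\odot$: $(m\odot x)(\omega)=m(x\cdot\omega)$ and $(m\odot n)(x)=m(n\odot x)$ for $m,n\in A^{**}$, $x\in A^*$, $\omega\in A$. $A$ is identified with its canonical image in $A^{**}$. $\mathcal{H}_r(A^* )$ is the set of bounded linear $T:A^*\to A^*$ with $T(x\cdot\omega)=T(x)\cdot\omega$ for all $x\in A^*,\omega\in A$; $\mathcal{H}_\ell(A^* )$ is the set of bounded linear $T:A^*\to A^*$ with $T(\omega\cdot x)=\omega\cdot T(x)$ for all $x\in A^*,\omega\in A$. $\mathcal{H}_r^\sigma(A^* )$ and $\mathcal{H}_\ell^\sigma(A^* )$ denote the subsets of normal (i.e. w*-w*-continuous, w* being $\sigma(A^*,A)$) elements. *)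

theory Defs
  imports "HOL-Analysis.Analysis"
begin

text \<open>
  Scalars are of class \<open>{real_normed_field, heine_borel}\<close>, whose members are (up to isomorphism)
  the real and the complex numbers, so that real and complex Banach algebras are treated at once.
  The classes \<open>real_normed_algebra\<close> and \<open>banach\<close> supply the ring structure, the
  submultiplicative norm and completeness; no unit is assumed.
\<close>

locale banach_algebra = vector_space smul
  for smul :: "'k::{real_normed_field,heine_borel} \<Rightarrow> 'a::{real_normed_algebra,banach} \<Rightarrow> 'a" +
  assumes smul_of_real: "smul (of_real r) a = r *\<^sub>R a"
    and norm_smul: "norm (smul c a) = norm c * norm a"
    and smul_mult_left: "smul c a * b = smul c (a * b)"
    and smul_mult_right: "a * smul c b = smul c (a * b)"

text \<open>
  Nets are rendered by a map \<open>e\<close> together with a proper filter on its index type.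
\<close>

definition bounded_approximate_identity :: "('i \<Rightarrow> 'a::real_normed_algebra) \<Rightarrow> 'i filter \<Rightarrow> bool" where
  "bounded_approximate_identity e F \<longleftrightarrow>
     F \<noteq> bot \<and> bounded (range e) \<and>
     (\<forall>a. ((\<lambda>i. e i * a) \<longlongrightarrow> a) F \<and> ((\<lambda>i. a * e i) \<longlongrightarrow> a) F)"

text \<open>
  The dual space is the set of bounded functionals linear over the scalar field; its norm is
  \<^const>\<open>onorm\<close>.  Maps defined on the dual space are made extensional, so that equality of
  such maps is equality on the dual space.
\<close>

definition dual_space ::
    "('k::{real_normed_field,heine_borel} \<Rightarrow> 'a::{real_normed_algebra,banach} \<Rightarrow> 'a) \<Rightarrow> ('a \<Rightarrow> 'k) set" where
  "dual_space smul = {x. bounded_linear x \<and> Vector_Spaces.linear smul (*) x}"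

definition bidual_space ::
    "('k::{real_normed_field,heine_borel} \<Rightarrow> 'a::{real_normed_algebra,banach} \<Rightarrow> 'a) \<Rightarrow> (('a \<Rightarrow> 'k) \<Rightarrow> 'k) set" where
  "bidual_space smul = {m \<in> extensional (dual_space smul).
     (\<forall>x\<in>dual_space smul. \<forall>y\<in>dual_space smul. m (\<lambda>a. x a + y a) = m x + m y) \<and>
     (\<forall>c. \<forall>x\<in>dual_space smul. m (\<lambda>a. c * x a) = c * m x) \<and>
     (\<exists>K. \<forall>x\<in>dual_space smul. norm (m x) \<le> K * onorm x)}"

definition canonical_embedding ::
    "('k::{real_normed_field,heine_borel} \<Rightarrow> 'a::{real_normed_algebra,banach} \<Rightarrow> 'a) \<Rightarrow> 'a \<Rightarrow> ('a \<Rightarrow> 'k) \<Rightarrow> 'k" where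
  "canonical_embedding smul a = (\<lambda>x\<in>dual_space smul. x a)"

text \<open>
  \<open>dual_right_act x w\<close> is $x \cdot w$ and \<open>dual_left_act w x\<close> is $w \cdot x$.
\<close>

definition dual_right_act :: "('a::times \<Rightarrow> 'k) \<Rightarrow> 'a \<Rightarrow> 'a \<Rightarrow> 'k" where
  "dual_right_act x w = (\<lambda>v. x (w * v))"

definition dual_left_act :: "'a::times \<Rightarrow> ('a \<Rightarrow> 'k) \<Rightarrow> 'a \<Rightarrow> 'k" where
  "dual_left_act w x = (\<lambda>v. x (v * w))"

definition arens_act :: "(('a::times \<Rightarrow> 'k) \<Rightarrow> 'k) \<Rightarrow> ('a \<Rightarrow> 'k) \<Rightarrow> 'a \<Rightarrow> 'k" where
  "arens_act m x = (\<lambda>w. m (dual_right_act x w))"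

definition arens_product ::
    "('k::{real_normed_field,heine_borel} \<Rightarrow> 'a::{real_normed_algebra,banach} \<Rightarrow> 'a) \<Rightarrow>
     (('a \<Rightarrow> 'k) \<Rightarrow> 'k) \<Rightarrow> (('a \<Rightarrow> 'k) \<Rightarrow> 'k) \<Rightarrow> ('a \<Rightarrow> 'k) \<Rightarrow> 'k" where
  "arens_product smul m n = (\<lambda>x\<in>dual_space smul. m (arens_act n x))"

definition bidual_subspace ::
    "('k::{real_normed_field,heine_borel} \<Rightarrow> 'a::{real_normed_algebra,banach} \<Rightarrow> 'a) \<Rightarrow>
     (('a \<Rightarrow> 'k) \<Rightarrow> 'k) set \<Rightarrow> bool" where
  "bidual_subspace smul J \<longleftrightarrow> J \<subseteq> bidual_space smul \<and>
     (\<lambda>x\<in>dual_space smul. 0) \<in> J \<and>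
     (\<forall>m\<in>J. \<forall>n\<in>J. (\<lambda>x\<in>dual_space smul. m x + n x) \<in> J) \<and>
     (\<forall>c. \<forall>m\<in>J. (\<lambda>x\<in>dual_space smul. c * m x) \<in> J)"

definition bidual_right_ideal ::
    "('k::{real_normed_field,heine_borel} \<Rightarrow> 'a::{real_normed_algebra,banach} \<Rightarrow> 'a) \<Rightarrow>
     (('a \<Rightarrow> 'k) \<Rightarrow> 'k) set \<Rightarrow> bool" where
  "bidual_right_ideal smul J \<longleftrightarrow> bidual_subspace smul J \<and>
     (\<forall>j\<in>J. \<forall>m\<in>bidual_space smul. arens_product smul j m \<in> J)"

definition bidual_left_ideal ::
    "('k::{real_normed_field,heine_borel} \<Rightarrow> 'a::{real_normed_algebra,banach} \<Rightarrow> 'a) \<Rightarrow>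
     (('a \<Rightarrow> 'k) \<Rightarrow> 'k) set \<Rightarrow> bool" where
  "bidual_left_ideal smul J \<longleftrightarrow> bidual_subspace smul J \<and>
     (\<forall>j\<in>J. \<forall>m\<in>bidual_space smul. arens_product smul m j \<in> J)"

definition dual_operators ::
    "('k::{real_normed_field,heine_borel} \<Rightarrow> 'a::{real_normed_algebra,banach} \<Rightarrow> 'a) \<Rightarrow>
     (('a \<Rightarrow> 'k) \<Rightarrow> ('a \<Rightarrow> 'k)) set" where
  "dual_operators smul = {T \<in> dual_space smul \<rightarrow>\<^sub>E dual_space smul.
     (\<forall>x\<in>dual_space smul. \<forall>y\<in>dual_space smul. T (\<lambda>a. x a + y a) = (\<lambda>a. T x a + T y a)) \<and>
     (\<forall>c. \<forall>x\<in>dual_space smul. T (\<lambda>a. c * x a) = (\<lambda>a. c * T x a)) \<and>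
     (\<exists>K. \<forall>x\<in>dual_space smul. onorm (T x) \<le> K * onorm x)}"

definition H_right ::
    "('k::{real_normed_field,heine_borel} \<Rightarrow> 'a::{real_normed_algebra,banach} \<Rightarrow> 'a) \<Rightarrow>
     (('a \<Rightarrow> 'k) \<Rightarrow> ('a \<Rightarrow> 'k)) set" where
  "H_right smul = {T \<in> dual_operators smul.
     \<forall>x\<in>dual_space smul. \<forall>w. T (dual_right_act x w) = dual_right_act (T x) w}"

definition H_left ::
    "('k::{real_normed_field,heine_borel} \<Rightarrow> 'a::{real_normed_algebra,banach} \<Rightarrow> 'a) \<Rightarrow>
     (('a \<Rightarrow> 'k) \<Rightarrow> ('a \<Rightarrow> 'k)) set" where
  "H_left smul = {T \<in> dual_operators smul.
     \<forall>x\<in>dual_space smul. \<forall>w. T (dual_left_act w x) = dual_left_act w (T x)}"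

text \<open>
  The topology $\sigma(A^*, A)$ is that of pointwise convergence on $A$, that is, the subspace
  topology which the dual inherits from the product of copies of the scalar field indexed by $A$.
\<close>

definition weak_star ::
    "('k::{real_normed_field,heine_borel} \<Rightarrow> 'a::{real_normed_algebra,banach} \<Rightarrow> 'a) \<Rightarrow> ('a \<Rightarrow> 'k) topology" where
  "weak_star smul = subtopology (product_topology (\<lambda>_. euclidean) UNIV) (dual_space smul)"

definition H_right_normal ::
    "('k::{real_normed_field,heine_borel} \<Rightarrow> 'a::{real_normed_algebra,banach} \<Rightarrow> 'a) \<Rightarrow>
     (('a \<Rightarrow> 'k) \<Rightarrow> ('a \<Rightarrow> 'k)) set" where
  "H_right_normal smul = {T \<in> H_right smul. continuous_map (weak_star smul) (weak_star smul) T}"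

definition H_left_normal ::
    "('k::{real_normed_field,heine_borel} \<Rightarrow> 'a::{real_normed_algebra,banach} \<Rightarrow> 'a) \<Rightarrow>
     (('a \<Rightarrow> 'k) \<Rightarrow> ('a \<Rightarrow> 'k)) set" where
  "H_left_normal smul = {T \<in> H_left smul. continuous_map (weak_star smul) (weak_star smul) T}"

end

theory Submission
  imports Defs
begin

text \<open>
  A bounded approximate identity makes every \<open>T\<close> in \<open>H_right\<close> of the form
  \<open>T x w = m (dual_right_act x w)\<close> with \<open>m\<close> in the bidual: take for \<open>m x\<close> the limit of
  \<open>T x (e i)\<close> along a subnet, which exists for all \<open>x\<close> at once by Tychonoff's theorem.  On the
  other hand, \<open>T\<close> is normal iff each functional \<open>x \<mapsto> T x w\<close> is weak-star continuous, that is,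
  evaluation at a point of the algebra; and that functional is the Arens product of \<open>w\<close> and \<open>m\<close>.
  The same holds for \<open>H_left\<close> with the two factors exchanged.
\<close>

section \<open>Simultaneous pointwise limits by compactness\<close>

text \<open>All \<open>g i\<close> lie in a product of closed balls, which are compact by
  \<open>heine_borel\<close>; by Tychonoff the product is compact, so the image filter has a cluster
  point \<open>m\<close>. Convergence in the product topology is pointwise, hence one filter
  \<open>G\<close> serves every \<open>x\<close>.\<close>

lemma pointwise_cluster_point:
  fixes g :: "'i \<Rightarrow> 'x \<Rightarrow> 'k::{real_normed_field,heine_borel}"
  assumes "F \<noteq> bot" and bound: "\<And>i x. norm (g i x) \<le> B x"
  obtains G m where "G \<le> F" "G \<noteq> bot" "\<And>x. ((\<lambda>i. g i x) \<longlongrightarrow> m x) G"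
proof -
  define C where "C = (PiE UNIV (\<lambda>x. cball 0 (B x)) :: ('x \<Rightarrow> 'k) set)"
  have "compact C"
    unfolding compactin_euclidean_iff[symmetric] C_def euclidean_product_topology[symmetric]
    by (simp add: compactin_PiE)
  moreover have "filtermap g F \<noteq> bot"
    using assms(1) by (simp add: filtermap_bot_iff)
  moreover have "eventually (\<lambda>f. f \<in> C) (filtermap g F)"
    using bound by (simp add: eventually_filtermap C_def PiE_iff)
  ultimately obtain m where m: "inf (nhds m) (filtermap g F) \<noteq> bot"
    unfolding compact_filter by blast
  \<comment> \<open>\<open>G\<close> plays the role of a subnet: it adds to \<open>F\<close> the
    preimages under \<open>g\<close> of the neighbourhoods of \<open>m\<close>.\<close>
  define G where "G = inf F (filtercomap g (nhds m))"
  have nontrivial: "G \<noteq> bot"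
  proof
    assume "G = bot"
    then obtain P Q where P: "eventually P F" and Q: "eventually Q (nhds m)"
      and no: "\<And>i. P i \<Longrightarrow> Q (g i) \<Longrightarrow> False"
      unfolding G_def trivial_limit_def eventually_inf eventually_filtercomap by metis
    \<comment> \<open>Wherever \<open>P\<close> holds, \<open>g i\<close> violates \<open>Q\<close>;
      so the image filter eventually leaves a neighbourhood of \<open>m\<close>, contradicting that
      \<open>m\<close> is a cluster point.\<close>
    from P have "eventually (\<lambda>f. \<not> Q f) (filtermap g F)"
      unfolding eventually_filtermap by (rule eventually_mono) (use no in blast)
    with Q have "eventually (\<lambda>f. False) (inf (nhds m) (filtermap g F))"
      unfolding eventually_inf by blast
    with m show False by (simp add: trivial_limit_def)
  qed
  have le: "G \<le> F" by (simp add: G_def)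
  have limit: "((\<lambda>i. g i x) \<longlongrightarrow> m x) G" for x
  proof -
    have lim: "(g \<longlongrightarrow> m) G"
      unfolding G_def by (rule filterlim_mono[OF filterlim_filtercomap order_refl inf_le2])
    show ?thesis
      using continuous_on_tendsto_compose[OF continuous_on_product_coordinates[of x] lim] by simp
  qed
  show thesis by (rule that[OF le nontrivial limit])
qed

section \<open>The dual space and the two module actions of the algebra on it\<close>

context banach_algebra
begin

lemma linear_functional_iff:
  "Vector_Spaces.linear smul (*) x \<longleftrightarrow>
     (\<forall>a b. x (a + b) = x a + x b) \<and> (\<forall>c a. x (smul c a) = c * x a)"
  unfolding Vector_Spaces.linear_def module_hom_def module_hom_axioms_def
  using vector_space_axioms vector_space_over_itself.vector_space_axioms
    module_axioms vector_space_over_itself.module_axioms by blast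

lemma dual_spaceD:
  assumes "x \<in> dual_space smul"
  shows "bounded_linear x" "x (a + b) = x a + x b" "x (smul c a) = c * x a"
    "norm (x a) \<le> onorm x * norm a" "0 \<le> onorm x" "x 0 = 0"
  using assms unfolding dual_space_def linear_functional_iff
  by (auto simp: onorm onorm_pos_le linear_simps)

lemma dual_spaceI:
  assumes add: "\<And>a b. x (a + b) = x a + x b" and scale: "\<And>c a. x (smul c a) = c * x a"
    and bound: "\<And>a. norm (x a) \<le> K * norm a"
  shows "x \<in> dual_space smul"
proof -
  \<comment> \<open>Homogeneity over the reals, demanded by \<open>bounded_linear\<close>, is scalar
    homogeneity at \<open>of_real r\<close>.\<close>
  have "x (r *\<^sub>R a) = r *\<^sub>R x a" for r a
    using scale[of "of_real r" a] by (simp add: smul_of_real scaleR_conv_of_real)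
  then have "bounded_linear x"
    by (intro bounded_linear_intro[where K=K]) (auto simp: add bound mult.commute)
  then show ?thesis
    by (simp add: dual_space_def linear_functional_iff add scale)
qed

lemma dual_space_zero: "(\<lambda>_. 0) \<in> dual_space smul"
  by (rule dual_spaceI[where K=0]) auto

lemma dual_space_add:
  assumes "x \<in> dual_space smul" "y \<in> dual_space smul"
  shows "(\<lambda>a. x a + y a) \<in> dual_space smul"
proof (rule dual_spaceI)
  show "norm (x a + y a) \<le> (onorm x + onorm y) * norm a" for a
    using norm_triangle_mono[OF dual_spaceD(4)[OF assms(1)] dual_spaceD(4)[OF assms(2)], of a a]
    by (simp add: algebra_simps)
qed (auto simp: dual_spaceD[OF assms(1)] dual_spaceD[OF assms(2)] algebra_simps)

lemma dual_space_scale: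
  assumes "x \<in> dual_space smul"
  shows "(\<lambda>a. c * x a) \<in> dual_space smul"
proof (rule dual_spaceI)
  show "norm (c * x a) \<le> (norm c * onorm x) * norm a" for a
    using mult_left_mono[OF dual_spaceD(4)[OF assms] norm_ge_zero[of c]]
    by (simp add: norm_mult mult.assoc)
qed (auto simp: dual_spaceD[OF assms] algebra_simps)

lemma dual_right_act_in_dual:
  assumes x: "x \<in> dual_space smul"
  shows "dual_right_act x w \<in> dual_space smul"
    and "onorm (dual_right_act x w) \<le> onorm x * norm w"
proof -
  have bound: "norm (dual_right_act x w a) \<le> (onorm x * norm w) * norm a" for a
  proof -
    have "norm (x (w * a)) \<le> onorm x * norm (w * a)" by (rule dual_spaceD[OF x])
    also have "\<dots> \<le> onorm x * (norm w * norm a)"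
      by (intro mult_left_mono norm_mult_ineq dual_spaceD[OF x])
    finally show ?thesis by (simp add: dual_right_act_def mult.assoc)
  qed
  then show "dual_right_act x w \<in> dual_space smul"
    by (rule dual_spaceI[rotated 2])
       (simp_all add: dual_right_act_def dual_spaceD[OF x] distrib_left smul_mult_right)
  show "onorm (dual_right_act x w) \<le> onorm x * norm w"
    by (rule onorm_bound[OF _ bound]) (simp add: dual_spaceD[OF x])
qed

lemma dual_left_act_in_dual:
  assumes x: "x \<in> dual_space smul"
  shows "dual_left_act w x \<in> dual_space smul"
    and "onorm (dual_left_act w x) \<le> onorm x * norm w"
proof -
  have bound: "norm (dual_left_act w x a) \<le> (onorm x * norm w) * norm a" for a
  proof -
    have "norm (x (a * w)) \<le> onorm x * norm (a * w)" by (rule dual_spaceD[OF x])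
    also have "\<dots> \<le> onorm x * (norm a * norm w)"
      by (intro mult_left_mono norm_mult_ineq dual_spaceD[OF x])
    finally show ?thesis by (simp add: dual_left_act_def mult_ac)
  qed
  then show "dual_left_act w x \<in> dual_space smul"
    by (rule dual_spaceI[rotated 2])
       (simp_all add: dual_left_act_def dual_spaceD[OF x] distrib_right smul_mult_left)
  show "onorm (dual_left_act w x) \<le> onorm x * norm w"
    by (rule onorm_bound[OF _ bound]) (simp add: dual_spaceD[OF x])
qed

section \<open>Weak-star continuous functionals and normal operators\<close>

text \<open>This is the linear algebra behind the identification of the weak-star dual. In the
  induction \<open>f\<close> is generalised because the hypothesis is applied to \<open>f\<close>
  corrected by a multiple of evaluation at the new point \<open>s\<close>.\<close>

lemma functional_in_span_of_evaluations:
  assumes "finite S"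
    and "\<And>x y. x \<in> dual_space smul \<Longrightarrow> y \<in> dual_space smul \<Longrightarrow> f (\<lambda>a. x a + y a) = f x + f y"
    and "\<And>c x. x \<in> dual_space smul \<Longrightarrow> f (\<lambda>a. c * x a) = c * f x"
    and "\<And>x. x \<in> dual_space smul \<Longrightarrow> (\<And>a. a \<in> S \<Longrightarrow> x a = 0) \<Longrightarrow> f x = 0"
  shows "\<exists>c. \<forall>x\<in>dual_space smul. f x = (\<Sum>a\<in>S. c a * x a)"
  using assms
proof (induction S arbitrary: f rule: finite_induct)
  case empty
  then show ?case by auto
next
  case (insert s S)
  note add = insert.prems(1) and scale = insert.prems(2) and vanish = insert.prems(3)
  show ?case
  proof (cases "\<exists>x\<in>dual_space smul. (\<forall>a\<in>S. x a = 0) \<and> x s \<noteq> 0")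
    \<comment> \<open>Vanishing on \<open>S\<close> already forces vanishing at \<open>s\<close>, so
      evaluation at \<open>s\<close> contributes nothing new and receives coefficient 0.\<close>
    case False
    have "\<exists>c. \<forall>x\<in>dual_space smul. f x = (\<Sum>a\<in>S. c a * x a)"
    proof (rule insert.IH[OF add scale])
      fix x assume "x \<in> dual_space smul" "\<And>a. a \<in> S \<Longrightarrow> x a = 0"
      then show "f x = 0" using False by (intro vanish) auto
    qed auto
    then obtain c where c: "\<forall>x\<in>dual_space smul. f x = (\<Sum>a\<in>S. c a * x a)" ..
    have "(\<Sum>a\<in>S. (c(s := 0)) a * x a) = (\<Sum>a\<in>S. c a * x a)" for x :: "'a \<Rightarrow> 'k"
      using insert.hyps by (intro sum.cong) auto
    then show ?thesis
      using c insert.hyps by (intro exI[of _ "c(s := 0)"]) (simp del: fun_upd_apply, simp)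
  next
    case True
    then obtain y where y: "y \<in> dual_space smul" "\<And>a. a \<in> S \<Longrightarrow> y a = 0" "y s \<noteq> 0" by blast
    \<comment> \<open>With this \<open>k\<close>, the functional \<open>f\<close> minus
      \<open>k\<close> times evaluation at \<open>s\<close> vanishes at \<open>y\<close>.\<close>
    define k where "k = f y / y s"
    have "\<exists>c. \<forall>x\<in>dual_space smul. f x - k * x s = (\<Sum>a\<in>S. c a * x a)"
    proof (rule insert.IH)
      fix x assume x: "x \<in> dual_space smul" and xS: "\<And>a. a \<in> S \<Longrightarrow> x a = 0"
      \<comment> \<open>Adding \<open>?c\<close> times \<open>y\<close> to \<open>x\<close> cancels
        the value at \<open>s\<close> and keeps the zeros on \<open>S\<close>, so the sum lies in
        the common kernel where \<open>f\<close> vanishes.\<close>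
      let ?c = "- (x s / y s)"
      have "f (\<lambda>a. x a + ?c * y a) = 0"
        using x y xS by (intro vanish dual_space_add dual_space_scale) auto
      moreover have "f (\<lambda>a. x a + ?c * y a) = f x + ?c * f y"
        using x y by (simp only: add scale dual_space_scale)
      ultimately show "f x - k * x s = 0" by (simp add: k_def field_simps)
    qed (simp_all add: add scale algebra_simps)
    then obtain c where c: "\<forall>x\<in>dual_space smul. f x - k * x s = (\<Sum>a\<in>S. c a * x a)" ..
    have "(\<Sum>a\<in>S. (c(s := k)) a * x a) = (\<Sum>a\<in>S. c a * x a)" for x :: "'a \<Rightarrow> 'k"
      using insert.hyps by (intro sum.cong) auto
    then show ?thesis
      using c insert.hyps
      by (intro exI[of _ "c(s := k)"]) (simp del: fun_upd_apply, simp add: algebra_simps)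
  qed
qed

lemma dual_space_sum:
  assumes "x \<in> dual_space smul" "finite S"
  shows "x (\<Sum>a\<in>S. smul (c a) a) = (\<Sum>a\<in>S. c a * x a)"
  using assms(2) by induction (simp_all add: dual_spaceD[OF assms(1)])

lemma topspace_weak_star: "topspace (weak_star smul) = dual_space smul"
  by (simp add: weak_star_def)

text \<open>Continuity at 0 gives a basic neighbourhood that constrains only finitely many
  coordinates. By scaling, \<open>f\<close> vanishes where these coordinates do, so it is a
  combination of the corresponding evaluations, and linearity of \<open>x\<close> merges them into
  one.\<close>

lemma weak_star_continuous_functional:
  assumes cont: "continuous_map (weak_star smul) euclidean f"
    and add: "\<And>x y. x \<in> dual_space smul \<Longrightarrow> y \<in> dual_space smul \<Longrightarrow> f (\<lambda>a. x a + y a) = f x + f y"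
    and scale: "\<And>c x. x \<in> dual_space smul \<Longrightarrow> f (\<lambda>a. c * x a) = c * f x"
  shows "\<exists>b. \<forall>x\<in>dual_space smul. f x = x b"
proof -
  have "openin (weak_star smul) {x \<in> topspace (weak_star smul). f x \<in> ball 0 1}"
    by (rule openin_continuous_map_preimage[OF cont]) simp
  then obtain U where U: "openin (product_topology (\<lambda>_. euclidean) UNIV) U"
    and eq: "{x \<in> dual_space smul. f x \<in> ball 0 1} = U \<inter> dual_space smul"
    unfolding topspace_weak_star unfolding weak_star_def openin_subtopology by blast
  have "f (\<lambda>_. 0) = 0"
    using scale[OF dual_space_zero, of 0] by simp
  then have "(\<lambda>_. 0) \<in> {x \<in> dual_space smul. f x \<in> ball 0 1}"
    using dual_space_zero by simp
  then have zero_in: "(\<lambda>_. 0) \<in> U"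
    unfolding eq by blast
  \<comment> \<open>A box around 0 inside \<open>U\<close>; only the finitely many coordinates with
    \<open>V a \<noteq> UNIV\<close> are restricted.\<close>
  have "\<exists>V. finite {a. V a \<noteq> UNIV} \<and> (\<lambda>_. 0) \<in> PiE UNIV V \<and> PiE UNIV V \<subseteq> U"
    using bspec[OF U[unfolded openin_product_topology_alt] zero_in] by (elim ex_forward) simp
  then obtain V where fin: "finite {a. V a \<noteq> UNIV}" and zero: "(\<lambda>_. 0) \<in> PiE UNIV V"
    and sub: "PiE UNIV V \<subseteq> U"
    by blast
  have "\<exists>c. \<forall>x\<in>dual_space smul. f x = (\<Sum>a\<in>{a. V a \<noteq> UNIV}. c a * x a)"
  proof (rule functional_in_span_of_evaluations[OF fin add scale])
    fix x assume x: "x \<in> dual_space smul" and van: "\<And>a. a \<in> {a. V a \<noteq> UNIV} \<Longrightarrow> x a = 0"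
    show "f x = 0"
    proof (rule ccontr)
      assume nz: "f x \<noteq> 0"
      \<comment> \<open>The rescaled \<open>x\<close> stays in the box, since its restricted
        coordinates are 0, yet \<open>f ?y = 1\<close> lies outside the open unit ball.\<close>
      let ?y = "\<lambda>a. inverse (f x) * x a"
      have "?y a \<in> V a" for a
        using van[of a] zero by (cases "V a = UNIV") (auto simp: PiE_iff)
      then have "?y \<in> U" using sub by (auto simp: PiE_iff)
      then have "f ?y \<in> ball 0 1"
        using eq dual_space_scale[OF x] by blast
      then show False using nz by (simp add: scale[OF x])
    qed
  qed
  then obtain c where "\<forall>x\<in>dual_space smul. f x = (\<Sum>a\<in>{a. V a \<noteq> UNIV}. c a * x a)" ..
  then show ?thesis
    by (intro exI[of _ "\<Sum>a\<in>{a. V a \<noteq> UNIV}. smul (c a) a"])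
       (auto simp: dual_space_sum[OF _ fin])
qed

text \<open>Continuity into a subspace of a product is tested coordinate by coordinate, and each
  coordinate \<open>x \<mapsto> T x w\<close> is a linear functional, to which the preceding result
  applies.\<close>

lemma continuous_map_weak_star_iff:
  assumes T: "T \<in> dual_operators smul"
  shows "continuous_map (weak_star smul) (weak_star smul) T \<longleftrightarrow>
    (\<forall>w. \<exists>b. \<forall>x\<in>dual_space smul. T x w = x b)"
proof -
  have range: "T \<in> dual_space smul \<rightarrow> dual_space smul"
    using T by (auto simp: dual_operators_def)
  have "continuous_map (weak_star smul) (weak_star smul) T \<longleftrightarrow>
      (\<forall>w. continuous_map (weak_star smul) euclidean (\<lambda>x. T x w))"
    using range
    by (subst (2) weak_star_def)
       (auto simp: continuous_map_in_subtopology continuous_map_componentwise_UNIV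
         topspace_weak_star)
  also have "\<dots> \<longleftrightarrow> (\<forall>w. \<exists>b. \<forall>x\<in>dual_space smul. T x w = x b)"
  proof (intro iff_allI iffI)
    fix w assume "continuous_map (weak_star smul) euclidean (\<lambda>x. T x w)"
    then show "\<exists>b. \<forall>x\<in>dual_space smul. T x w = x b"
      using T by (intro weak_star_continuous_functional) (auto simp: dual_operators_def)
  next
    fix w assume "\<exists>b. \<forall>x\<in>dual_space smul. T x w = x b"
    then obtain b where b: "\<And>x. x \<in> dual_space smul \<Longrightarrow> T x w = x b" by blast
    have "continuous_map (weak_star smul) euclidean (\<lambda>x. x b)"
      unfolding weak_star_def
      by (intro continuous_map_from_subtopology continuous_map_product_projection) simp
    then show "continuous_map (weak_star smul) euclidean (\<lambda>x. T x w)"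
      by (rule continuous_map_eq) (simp add: topspace_weak_star b)
  qed
  finally show ?thesis .
qed

section \<open>Operators on the dual induced by elements of the bidual\<close>

lemma bidual_spaceD:
  assumes "m \<in> bidual_space smul"
  shows "x \<in> dual_space smul \<Longrightarrow> y \<in> dual_space smul \<Longrightarrow> m (\<lambda>a. x a + y a) = m x + m y"
    and "x \<in> dual_space smul \<Longrightarrow> m (\<lambda>a. c * x a) = c * m x"
  using assms by (auto simp: bidual_space_def)

lemma bidual_space_bound:
  assumes "m \<in> bidual_space smul"
  obtains K where "K \<ge> 0" "\<And>x. x \<in> dual_space smul \<Longrightarrow> norm (m x) \<le> K * onorm x"
proof -
  obtain K where K: "\<And>x. x \<in> dual_space smul \<Longrightarrow> norm (m x) \<le> K * onorm x"
    using assms unfolding bidual_space_def by blast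
  \<comment> \<open>The given constant may be negative; its absolute value can be used in
    monotonicity arguments.\<close>
  have "norm (m x) \<le> \<bar>K\<bar> * onorm x" if "x \<in> dual_space smul" for x
    using K[OF that] mult_right_mono[OF abs_ge_self[of K] dual_spaceD(5)[OF that]] by linarith
  then show thesis using that[of "\<bar>K\<bar>"] by simp
qed

text \<open>The abstract \<open>act\<close> stands for \<open>dual_right_act\<close> and for
  \<open>dual_left_act\<close> with its arguments exchanged, so both constructions share one
  argument. The bound \<open>K\<close> of \<open>m\<close> also bounds the operator, since
  \<open>act\<close> satisfies \<open>act_bound\<close>.\<close>

lemma dual_operator_of_bidual:
  fixes act :: "('a \<Rightarrow> 'k) \<Rightarrow> 'a \<Rightarrow> 'a \<Rightarrow> 'k"
  assumes m: "m \<in> bidual_space smul"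
    and act: "\<And>x w. x \<in> dual_space smul \<Longrightarrow> act x w \<in> dual_space smul"
    and act_bound: "\<And>x w. x \<in> dual_space smul \<Longrightarrow> onorm (act x w) \<le> onorm x * norm w"
    and act_add: "\<And>x v w. x \<in> dual_space smul \<Longrightarrow> act x (v + w) = (\<lambda>a. act x v a + act x w a)"
    and act_scale: "\<And>x c w. x \<in> dual_space smul \<Longrightarrow> act x (smul c w) = (\<lambda>a. c * act x w a)"
    and add_act: "\<And>x y w. act (\<lambda>a. x a + y a) w = (\<lambda>a. act x w a + act y w a)"
    and scale_act: "\<And>x c w. act (\<lambda>a. c * x a) w = (\<lambda>a. c * act x w a)"
  shows "(\<lambda>x\<in>dual_space smul. \<lambda>w. m (act x w)) \<in> dual_operators smul"
proof -
  obtain K where K: "K \<ge> 0" "\<And>x. x \<in> dual_space smul \<Longrightarrow> norm (m x) \<le> K * onorm x"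
    by (rule bidual_space_bound[OF m]) blast
  have bound: "norm (m (act x w)) \<le> (K * onorm x) * norm w" if x: "x \<in> dual_space smul" for x w
    using K(2)[OF act[OF x], of w] mult_left_mono[OF act_bound[OF x, of w] K(1)]
    by (simp add: mult.assoc)
  have in_dual: "(\<lambda>w. m (act x w)) \<in> dual_space smul" if x: "x \<in> dual_space smul" for x
    by (rule dual_spaceI[OF _ _ bound[OF x]])
       (simp_all add: act_add[OF x] act_scale[OF x] bidual_spaceD[OF m] act[OF x])
  have "onorm (\<lambda>w. m (act x w)) \<le> K * onorm x" if x: "x \<in> dual_space smul" for x
    by (rule onorm_bound[OF _ bound[OF x]]) (simp add: K dual_spaceD[OF x])
  then show ?thesis
    unfolding dual_operators_def
    by (auto simp: in_dual dual_space_add dual_space_scale add_act scale_act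
        bidual_spaceD[OF m] act intro!: exI[of _ K])
qed

lemma arens_act_dual_operator:
  assumes m: "m \<in> bidual_space smul"
  shows "(\<lambda>x\<in>dual_space smul. arens_act m x) \<in> dual_operators smul"
  unfolding arens_act_def
  by (rule dual_operator_of_bidual[OF m])
     (simp_all add: dual_right_act_in_dual,
       simp_all add: dual_right_act_def distrib_right smul_mult_left dual_spaceD)

text \<open>Associativity gives (x.w).v = x.(wv), so applying the operator to x.w and evaluating at
  v gives its value for x at wv.\<close>

lemma arens_act_H_right:
  assumes m: "m \<in> bidual_space smul"
  shows "(\<lambda>x\<in>dual_space smul. arens_act m x) \<in> H_right smul"
  using arens_act_dual_operator[OF m] dual_right_act_in_dual(1)
  by (auto simp: H_right_def) (auto simp: arens_act_def dual_right_act_def mult.assoc)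

text \<open>The formula is the action underlying the second Arens product. It commutes with the left
  action because v.(w.x) = (vw).x.\<close>

lemma left_act_H_left:
  assumes m: "m \<in> bidual_space smul"
  shows "(\<lambda>x\<in>dual_space smul. \<lambda>w. m (dual_left_act w x)) \<in> H_left smul"
proof -
  have "(\<lambda>x\<in>dual_space smul. \<lambda>w. m (dual_left_act w x)) \<in> dual_operators smul"
    by (rule dual_operator_of_bidual[OF m])
       (simp_all add: dual_left_act_in_dual,
         simp_all add: dual_left_act_def distrib_left smul_mult_right dual_spaceD)
  then show ?thesis
    using dual_left_act_in_dual(1)
    by (auto simp: H_left_def) (auto simp: dual_left_act_def mult.assoc)
qed

section \<open>Arens products with elements of the algebra, and the ideal conditions\<close>

text \<open>Multiplying by an embedded \<open>w\<close> from the left evaluates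
  \<open>arens_act m x\<close> at \<open>w\<close>. That \<open>arens_act m x\<close> lies in the
  dual matters, as the embedding has its intended values only there.\<close>

lemma arens_product_embedding_left:
  assumes m: "m \<in> bidual_space smul"
  shows "arens_product smul (canonical_embedding smul w) m =
    (\<lambda>x\<in>dual_space smul. m (dual_right_act x w))"
  using arens_act_dual_operator[OF m]
  by (auto simp: arens_product_def canonical_embedding_def dual_operators_def
      arens_act_def PiE_iff intro!: restrict_ext)

lemma arens_product_embedding_right:
  "arens_product smul m (canonical_embedding smul w) =
    (\<lambda>x\<in>dual_space smul. m (dual_left_act w x))"
  unfolding arens_product_def
proof (rule restrict_ext)
  fix x assume "x \<in> dual_space smul"
  then have "arens_act (canonical_embedding smul w) x = dual_left_act w x"
    by (simp add: arens_act_def canonical_embedding_def dual_right_act_in_dual)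
       (simp add: dual_right_act_def dual_left_act_def)
  then show "m (arens_act (canonical_embedding smul w) x) = m (dual_left_act w x)" by simp
qed

text \<open>This settles the linear part of both ideal conditions, leaving only absorption of
  products.\<close>

lemma bidual_subspace_embedding: "bidual_subspace smul (range (canonical_embedding smul))"
  unfolding bidual_subspace_def
proof (intro conjI ballI allI)
  show "range (canonical_embedding smul) \<subseteq> bidual_space smul"
  proof
    fix j assume "j \<in> range (canonical_embedding smul)"
    then obtain a where "j = canonical_embedding smul a" by blast
    moreover have "norm (x a) \<le> norm a * onorm x" if "x \<in> dual_space smul" for x
      using dual_spaceD(4)[OF that, of a] by (simp add: mult.commute)
    ultimately show "j \<in> bidual_space smul"
      by (auto simp: bidual_space_def canonical_embedding_def dual_space_add dual_space_scale)
  qed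
  show "(\<lambda>x\<in>dual_space smul. 0) \<in> range (canonical_embedding smul)"
    by (rule range_eqI[of _ _ 0])
       (auto simp: canonical_embedding_def dual_spaceD intro!: restrict_ext)
next
  fix m n assume "m \<in> range (canonical_embedding smul)" "n \<in> range (canonical_embedding smul)"
  then obtain a b where "m = canonical_embedding smul a" "n = canonical_embedding smul b" by blast
  then show "(\<lambda>x\<in>dual_space smul. m x + n x) \<in> range (canonical_embedding smul)"
    by (intro range_eqI[of _ _ "a + b"])
       (auto simp: canonical_embedding_def dual_spaceD intro!: restrict_ext)
next
  fix c m assume "m \<in> range (canonical_embedding smul)"
  then obtain a where "m = canonical_embedding smul a" by blast
  then show "(\<lambda>x\<in>dual_space smul. c * m x) \<in> range (canonical_embedding smul)"
    by (intro range_eqI[of _ _ "smul c a"])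
       (auto simp: canonical_embedding_def dual_spaceD intro!: restrict_ext)
qed

text \<open>Membership in the algebra is thereby put in the same form as the normality criterion
  \<open>continuous_map_weak_star_iff\<close>.\<close>

lemma restrict_in_range_embedding_iff:
  "restrict f (dual_space smul) \<in> range (canonical_embedding smul) \<longleftrightarrow>
    (\<exists>b. \<forall>x\<in>dual_space smul. f x = x b)"
  by (auto simp: canonical_embedding_def image_iff fun_eq_iff restrict_def)

lemma bidual_right_ideal_iff:
  "bidual_right_ideal smul (range (canonical_embedding smul)) \<longleftrightarrow>
    (\<forall>m\<in>bidual_space smul. \<forall>w. \<exists>b. \<forall>x\<in>dual_space smul. m (dual_right_act x w) = x b)"
  unfolding bidual_right_ideal_def
  by (auto simp: bidual_subspace_embedding arens_product_embedding_left
      restrict_in_range_embedding_iff)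

lemma bidual_left_ideal_iff:
  "bidual_left_ideal smul (range (canonical_embedding smul)) \<longleftrightarrow>
    (\<forall>m\<in>bidual_space smul. \<forall>w. \<exists>b. \<forall>x\<in>dual_space smul. m (dual_left_act w x) = x b)"
  unfolding bidual_left_ideal_def
  by (auto simp: bidual_subspace_embedding arens_product_embedding_right
      restrict_in_range_embedding_iff)

section \<open>Representation of module operators by elements of the bidual\<close>

text \<open>The values \<open>T x (e i)\<close> are bounded by a constant times
  \<open>onorm x\<close>, uniformly in \<open>i\<close>. Compactness provides limits for all
  \<open>x\<close> along one filter, and linearity and the bound pass to the limit.\<close>

lemma bidual_limit_along_bounded_net:
  fixes e :: "'i \<Rightarrow> 'a"
  assumes "F \<noteq> bot" "bounded (range e)" and T: "T \<in> dual_operators smul"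
  obtains G m where "G \<le> F" "G \<noteq> bot" "m \<in> bidual_space smul"
    "\<And>x. x \<in> dual_space smul \<Longrightarrow> ((\<lambda>i. T x (e i)) \<longlongrightarrow> m x) G"
proof -
  obtain L where L: "\<And>i. norm (e i) \<le> L"
    using assms(2) by (auto simp: bounded_iff)
  have Tdual: "T x \<in> dual_space smul" if "x \<in> dual_space smul" for x
    using T that by (auto simp: dual_operators_def)
  obtain K where K: "\<And>x. x \<in> dual_space smul \<Longrightarrow> onorm (T x) \<le> K * onorm x"
    using T unfolding dual_operators_def by blast
  have L0: "0 \<le> L" using L norm_ge_zero order_trans by blast
  have bound: "norm (T x (e i)) \<le> (K * L) * onorm x" if x: "x \<in> dual_space smul" for x i
  proof -
    have "norm (T x (e i)) \<le> onorm (T x) * norm (e i)" by (rule dual_spaceD[OF Tdual[OF x]])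
    also have "\<dots> \<le> onorm (T x) * L" by (intro mult_left_mono L dual_spaceD[OF Tdual[OF x]])
    also have "\<dots> \<le> (K * onorm x) * L" by (intro mult_right_mono K x L0)
    finally show ?thesis by (simp add: mult_ac)
  qed
  \<comment> \<open>Extension by 0 off the dual, since the compactness result needs a bound at every
    function.\<close>
  let ?g = "\<lambda>i x. if x \<in> dual_space smul then T x (e i) else 0"
  have "norm (?g i x) \<le> (if x \<in> dual_space smul then (K * L) * onorm x else 0)" for i x
    using bound by simp
  then obtain G m where G: "G \<le> F" "G \<noteq> bot" and lim: "\<And>x. ((\<lambda>i. ?g i x) \<longlongrightarrow> m x) G"
    using pointwise_cluster_point[OF assms(1), of ?g
        "\<lambda>x. if x \<in> dual_space smul then (K * L) * onorm x else 0"] by blast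
  have lim: "((\<lambda>i. T x (e i)) \<longlongrightarrow> m x) G" if "x \<in> dual_space smul" for x
    using lim[of x] that by simp
  have "m (\<lambda>a. x a + y a) = m x + m y" if x: "x \<in> dual_space smul" and y: "y \<in> dual_space smul" for x y
  proof (rule tendsto_unique[OF G(2)])
    show "((\<lambda>i. T x (e i) + T y (e i)) \<longlongrightarrow> m (\<lambda>a. x a + y a)) G"
      using lim[OF dual_space_add[OF x y]] T x y by (simp add: dual_operators_def)
    show "((\<lambda>i. T x (e i) + T y (e i)) \<longlongrightarrow> m x + m y) G"
      by (intro tendsto_add lim x y)
  qed
  moreover have "m (\<lambda>a. c * x a) = c * m x" if x: "x \<in> dual_space smul" for c x
  proof (rule tendsto_unique[OF G(2)])
    show "((\<lambda>i. c * T x (e i)) \<longlongrightarrow> m (\<lambda>a. c * x a)) G"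
      using lim[OF dual_space_scale[OF x]] T x by (simp add: dual_operators_def)
    show "((\<lambda>i. c * T x (e i)) \<longlongrightarrow> c * m x) G"
      by (intro tendsto_mult_left lim x)
  qed
  moreover have "norm (m x) \<le> (K * L) * onorm x" if x: "x \<in> dual_space smul" for x
    by (rule tendsto_upperbound[OF tendsto_norm[OF lim[OF x]] _ G(2)]) (simp add: bound[OF x])
  \<comment> \<open>Elements of the bidual are extensional, so the limit is cut down to the
    dual.\<close>
  ultimately have "restrict m (dual_space smul) \<in> bidual_space smul"
    by (auto simp: bidual_space_def dual_space_add dual_space_scale intro!: exI[of _ "K * L"])
  then show thesis
    using that[OF G, of "restrict m (dual_space smul)"] lim by simp
qed

text \<open>The value of T(x.w) at \<open>e i\<close> equals \<open>T x (w * e i)\<close>. Along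
  \<open>G\<close> the former tends to \<open>m (dual_right_act x w)\<close>, the latter to
  \<open>T x w\<close> because \<open>w * e i\<close> tends to \<open>w\<close>.\<close>

lemma H_right_representation:
  fixes e :: "'i \<Rightarrow> 'a"
  assumes e: "bounded_approximate_identity e F" and T: "T \<in> H_right smul"
  obtains m where "m \<in> bidual_space smul"
    "\<And>x w. x \<in> dual_space smul \<Longrightarrow> m (dual_right_act x w) = T x w"
proof -
  have Top: "T \<in> dual_operators smul" using T by (simp add: H_right_def)
  obtain G m where G: "G \<le> F" "G \<noteq> bot" and m: "m \<in> bidual_space smul"
    and lim: "\<And>x. x \<in> dual_space smul \<Longrightarrow> ((\<lambda>i. T x (e i)) \<longlongrightarrow> m x) G"
    using bidual_limit_along_bounded_net[OF _ _ Top] e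
    unfolding bounded_approximate_identity_def by metis
  have "m (dual_right_act x w) = T x w" if x: "x \<in> dual_space smul" for x w
  proof (rule tendsto_unique[OF G(2)])
    have "T (dual_right_act x w) = dual_right_act (T x) w"
      using T x by (simp add: H_right_def)
    then show "((\<lambda>i. T x (w * e i)) \<longlongrightarrow> m (dual_right_act x w)) G"
      using lim[OF dual_right_act_in_dual(1)[OF x, of w]] by (simp add: dual_right_act_def)
    have "T x \<in> dual_space smul" using Top x by (auto simp: dual_operators_def)
    then show "((\<lambda>i. T x (w * e i)) \<longlongrightarrow> T x w) G"
      using e unfolding bounded_approximate_identity_def
      by (intro bounded_linear.tendsto[OF dual_spaceD(1)] tendsto_mono[OF G(1)]) auto
  qed
  with m show thesis by (rule that)
qed

text \<open>The same comparison of limits, now with \<open>T x (e i * w)\<close> and the other half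
  of the approximate identity property.\<close>

lemma H_left_representation:
  fixes e :: "'i \<Rightarrow> 'a"
  assumes e: "bounded_approximate_identity e F" and T: "T \<in> H_left smul"
  obtains m where "m \<in> bidual_space smul"
    "\<And>x w. x \<in> dual_space smul \<Longrightarrow> m (dual_left_act w x) = T x w"
proof -
  have Top: "T \<in> dual_operators smul" using T by (simp add: H_left_def)
  obtain G m where G: "G \<le> F" "G \<noteq> bot" and m: "m \<in> bidual_space smul"
    and lim: "\<And>x. x \<in> dual_space smul \<Longrightarrow> ((\<lambda>i. T x (e i)) \<longlongrightarrow> m x) G"
    using bidual_limit_along_bounded_net[OF _ _ Top] e
    unfolding bounded_approximate_identity_def by metis
  have "m (dual_left_act w x) = T x w" if x: "x \<in> dual_space smul" for x w
  proof (rule tendsto_unique[OF G(2)])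
    have "T (dual_left_act w x) = dual_left_act w (T x)"
      using T x by (simp add: H_left_def)
    then show "((\<lambda>i. T x (e i * w)) \<longlongrightarrow> m (dual_left_act w x)) G"
      using lim[OF dual_left_act_in_dual(1)[OF x, of w]] by (simp add: dual_left_act_def)
    have "T x \<in> dual_space smul" using Top x by (auto simp: dual_operators_def)
    then show "((\<lambda>i. T x (e i * w)) \<longlongrightarrow> T x w) G"
      using e unfolding bounded_approximate_identity_def
      by (intro bounded_linear.tendsto[OF dual_spaceD(1)] tendsto_mono[OF G(1)]) auto
  qed
  with m show thesis by (rule that)
qed

section \<open>The two equivalences\<close>

lemma H_right_eq_normal_iff:
  fixes e :: "'i \<Rightarrow> 'a"
  assumes e: "bounded_approximate_identity e F"
  shows "H_right smul = H_right_normal smul \<longleftrightarrow>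
    bidual_right_ideal smul (range (canonical_embedding smul))"
proof -
  \<comment> \<open>The normal operators form a subset by definition, so equality says that every
    \<open>T\<close> passes the normality criterion.\<close>
  have "H_right smul = H_right_normal smul \<longleftrightarrow>
      (\<forall>T\<in>H_right smul. \<forall>w. \<exists>b. \<forall>x\<in>dual_space smul. T x w = x b)"
    using continuous_map_weak_star_iff by (auto simp: H_right_normal_def H_right_def)
  also have "\<dots> \<longleftrightarrow>
      (\<forall>m\<in>bidual_space smul. \<forall>w. \<exists>b. \<forall>x\<in>dual_space smul. m (dual_right_act x w) = x b)"
  proof (intro iffI ballI)
    fix m assume *: "\<forall>T\<in>H_right smul. \<forall>w. \<exists>b. \<forall>x\<in>dual_space smul. T x w = x b"
      and "m \<in> bidual_space smul"
    \<comment> \<open>The hypothesis is applied to the operator induced by \<open>m\<close>, whose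
      value for \<open>x\<close> at \<open>w\<close> is
      \<open>m (dual_right_act x w)\<close>.\<close>
    with bspec[OF * arens_act_H_right[of m]]
    show "\<forall>w. \<exists>b. \<forall>x\<in>dual_space smul. m (dual_right_act x w) = x b"
      by (simp add: arens_act_def)
  next
    fix T
    assume *: "\<forall>m\<in>bidual_space smul. \<forall>w. \<exists>b. \<forall>x\<in>dual_space smul. m (dual_right_act x w) = x b"
      and T: "T \<in> H_right smul"
    obtain m where "m \<in> bidual_space smul"
      "\<And>x w. x \<in> dual_space smul \<Longrightarrow> m (dual_right_act x w) = T x w"
      by (rule H_right_representation[OF e T]) blast
    with * show "\<forall>w. \<exists>b. \<forall>x\<in>dual_space smul. T x w = x b" by metis
  qed
  finally show ?thesis by (simp only: bidual_right_ideal_iff)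
qed

lemma H_left_eq_normal_iff:
  fixes e :: "'i \<Rightarrow> 'a"
  assumes e: "bounded_approximate_identity e F"
  shows "H_left smul = H_left_normal smul \<longleftrightarrow>
    bidual_left_ideal smul (range (canonical_embedding smul))"
proof -
  have "H_left smul = H_left_normal smul \<longleftrightarrow>
      (\<forall>T\<in>H_left smul. \<forall>w. \<exists>b. \<forall>x\<in>dual_space smul. T x w = x b)"
    using continuous_map_weak_star_iff by (auto simp: H_left_normal_def H_left_def)
  also have "\<dots> \<longleftrightarrow>
      (\<forall>m\<in>bidual_space smul. \<forall>w. \<exists>b. \<forall>x\<in>dual_space smul. m (dual_left_act w x) = x b)"
  proof (intro iffI ballI)
    fix m assume *: "\<forall>T\<in>H_left smul. \<forall>w. \<exists>b. \<forall>x\<in>dual_space smul. T x w = x b"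
      and "m \<in> bidual_space smul"
    \<comment> \<open>Here the operator built from \<open>dual_left_act\<close> replaces the Arens
      action.\<close>
    with bspec[OF * left_act_H_left[of m]]
    show "\<forall>w. \<exists>b. \<forall>x\<in>dual_space smul. m (dual_left_act w x) = x b"
      by simp
  next
    fix T
    assume *: "\<forall>m\<in>bidual_space smul. \<forall>w. \<exists>b. \<forall>x\<in>dual_space smul. m (dual_left_act w x) = x b"
      and T: "T \<in> H_left smul"
    obtain m where "m \<in> bidual_space smul"
      "\<And>x w. x \<in> dual_space smul \<Longrightarrow> m (dual_left_act w x) = T x w"
      by (rule H_left_representation[OF e T]) blast
    with * show "\<forall>w. \<exists>b. \<forall>x\<in>dual_space smul. T x w = x b" by metis
  qed
  finally show ?thesis by (simp only: bidual_left_ideal_iff)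
qed

end

theorem corollary2p7:
  fixes smul :: "'k::{real_normed_field,heine_borel} \<Rightarrow> 'a::{real_normed_algebra,banach} \<Rightarrow> 'a"
    and e :: "'i \<Rightarrow> 'a" and F :: "'i filter"
  assumes "banach_algebra smul"
    and "bounded_approximate_identity e F"
  shows "(H_right smul = H_right_normal smul \<longleftrightarrow>
            bidual_right_ideal smul (range (canonical_embedding smul))) \<and>
         (H_left smul = H_left_normal smul \<longleftrightarrow>
            bidual_left_ideal smul (range (canonical_embedding smul)))"
  using banach_algebra.H_right_eq_normal_iff[OF assms]
    banach_algebra.H_left_eq_normal_iff[OF assms] by blast

end
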